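(* There are a real number $\gamma$ with $1<\gamma<\varphi$, where $\varphi=(1+\sqrt5)/2$, and positive real numbers $\alpha,\beta$ such that every term of both sequences $(\lfloor\alpha\gamma^n\rfloor)_{n\ge0}$ and $(\lfloor\beta\gamma^n\rfloor)_{n\ge0}$ is even, and $$\frac{\beta}{\alpha}\ne r\gamma^k\qquad\text{for all } r\in\mathbb Q,\ k\in\mathbb Z.$$ In particular, $\alpha/\beta$ is irrational, neither of the two sequences is a tail of the other, and their interleaving is not complete.
   Context: A sequence of integers is complete if every sufficiently large integer is a sum of a finite selection of its terms with distinct indices. The interleaving of two sequences is the sequence consisting of all terms of both, with repeated values retained as separate occurrences. A tail of a sequence $(x_n)_{n\ge0}$ is a sequence $(x_{n+k})_{n\ge0}$ for some integer $k\ge0$. *)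

theory Defs
  imports Complex_Main
begin

definition complete_seq :: "(nat \<Rightarrow> int) \<Rightarrow> bool" where
  "complete_seq x \<longleftrightarrow> (\<exists>N::int. \<forall>m\<ge>N. \<exists>I. finite I \<and> m = (\<Sum>i\<in>I. x i))"

text \<open>The order in which the two sequences are merged is immaterial for completeness;
  here the terms alternate, so equal values of x and y keep distinct indices.\<close>

definition interleaving :: "(nat \<Rightarrow> 'a) \<Rightarrow> (nat \<Rightarrow> 'a) \<Rightarrow> nat \<Rightarrow> 'a" where
  "interleaving x y n = (if even n then x (n div 2) else y (n div 2))"

definition is_tail_of :: "(nat \<Rightarrow> 'a) \<Rightarrow> (nat \<Rightarrow> 'a) \<Rightarrow> bool" where
  "is_tail_of y x \<longleftrightarrow> (\<exists>k. y = (\<lambda>n. x (n + k)))"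

definition floor_geom :: "real \<Rightarrow> real \<Rightarrow> nat \<Rightarrow> int" where
  "floor_geom \<alpha> \<gamma> n = \<lfloor>\<alpha> * \<gamma> ^ n\<rfloor>"

definition golden_ratio :: real where
  "golden_ratio = (1 + sqrt 5) / 2"

end

theory Submission
  imports Defs
begin

text \<open>
  Let \<open>\<gamma> = 1.534...\<close> be the real root of \<open>P(x) = x^5 - x^3 - x^2 - x - 1\<close>. Two features of \<open>P\<close>
  make the construction work: \<open>\<gamma>\<close> is a Pisot number, so that every integer solution \<open>w\<close> of the
  recurrence with characteristic polynomial \<open>P\<close> satisfies \<open>w n = A \<gamma>^n + o(1)\<close>; and \<open>P(1) = -3\<close>,
  so that the constant \<open>1\<close> solves the recurrence modulo \<open>3\<close>. If \<open>w\<close> is an integer solution whose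
  terms are all \<open>1\<close> modulo \<open>3\<close>, say \<open>w n = 3 u n + 1\<close>, then
  \<open>(2/3) A \<gamma>^n = 2 u n + 2/3 + o(1)\<close>, and its floor is the even number \<open>2 u n\<close> for all large \<open>n\<close>
  (\<open>eventually_even_floor\<close>). Absorbing a power of \<open>\<gamma>\<close> into the coefficient makes all the floors even.

  Two solutions are used, with initial terms \<open>1, 1, 1, 1, 1\<close> and \<open>1, 1, 1, 4, 1\<close>; let \<open>A\<close> and \<open>B\<close> be
  their leading coefficients. A relation \<open>B / A = r \<gamma>^k\<close> with \<open>r\<close> rational becomes, after clearing
  denominators, a proportionality up to \<open>o(1)\<close> between one solution and a shift of the other. Both
  sides are integers, so the difference vanishes eventually, and since the recurrence
  can be run backwards it vanishes identically (\<open>proportional_of_dominant_coeff\<close>). The initial terms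
  exclude this (\<open>wseq_not_proportional_to_later\<close>).

  The Pisot property, that the other roots of \<open>P\<close> lie in the open unit disc, enters in the form that
  the solutions of the recurrence with characteristic polynomial \<open>P(x) / (x - \<gamma>)\<close> tend to \<open>0\<close>
  (\<open>cofactor_kernel_tendsto_0\<close>). This follows from a quadratic form that
  decreases along such solutions, without any information on the roots.
\<close>

section \<open>The recurrence\<close>

definition recurrent :: "(nat \<Rightarrow> 'a::comm_ring_1) \<Rightarrow> bool" where
  "recurrent w \<longleftrightarrow> (\<forall>n. w (n + 5) = w (n + 3) + w (n + 2) + w (n + 1) + w n)"

lemma recurrentD:
  "recurrent w \<Longrightarrow> w (n + 5) = w (n + 3) + w (n + 2) + w (n + 1) + w n"
  by (simp add: recurrent_def)

text \<open>One free initial term is enough: all initial terms have to be \<open>1\<close> modulo \<open>3\<close>, and changing the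
  term of index \<open>3\<close> already yields a solution that is not a multiple of a shift of the old one.\<close>

fun wseq :: "int \<Rightarrow> nat \<Rightarrow> int" where
  "wseq c n = (if n < 5 then if n = 3 then c else 1
     else wseq c (n - 2) + wseq c (n - 3) + wseq c (n - 4) + wseq c (n - 5))"

\<comment> \<open>As a rewrite rule the defining equation would unfold itself forever.\<close>
declare wseq.simps [simp del]

lemma wseq_initial:
  "wseq c 0 = 1" "wseq c 1 = 1" "wseq c 2 = 1" "wseq c 3 = c" "wseq c 4 = 1"
  by (simp_all add: wseq.simps)

lemma recurrent_wseq: "recurrent (wseq c)"
  unfolding recurrent_def
proof
  fix n
  show "wseq c (n + 5) = wseq c (n + 3) + wseq c (n + 2) + wseq c (n + 1) + wseq c n"
    by (subst wseq.simps) (simp add: add.commute)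
qed

lemma wseq_pos:
  assumes "c > 0"
  shows "wseq c n > 0"
proof (induction n rule: less_induct)
  case (less n)
  show ?case
  proof (cases "n < 5")
    case True
    then show ?thesis using assms by (simp add: wseq.simps)
  next
    case False
    with less.IH[of "n - 2"] less.IH[of "n - 3"] less.IH[of "n - 4"] less.IH[of "n - 5"]
    show ?thesis by (subst wseq.simps) simp
  qed
qed

lemma wseq_mod_3:
  assumes "c mod 3 = 1"
  shows "wseq c n mod 3 = 1"
proof (induction n rule: less_induct)
  case (less n)
  show ?case
  proof (cases "n < 5")
    case True
    then show ?thesis using assms by (simp add: wseq.simps)
  next
    case False
    have "(wseq c (n - 2) + wseq c (n - 3) + wseq c (n - 4) + wseq c (n - 5)) mod 3
      = (1 + 1 + 1 + 1) mod 3"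
      by (intro mod_add_cong) (use False less.IH in simp_all)
    with False show ?thesis by (subst wseq.simps) simp
  qed
qed

lemma wseq_step_two:
  assumes "c > 0" "n \<ge> 3"
  shows "wseq c n < wseq c (n + 2)"
proof -
  obtain m where n: "n = m + 3"
    using assms(2) by (metis add.commute le_Suc_ex)
  have "n + 2 = m + 5" using n by simp
  then show ?thesis
    using recurrentD[OF recurrent_wseq, of c m] n
      wseq_pos[OF assms(1), of "m + 2"] wseq_pos[OF assms(1), of "m + 1"]
      wseq_pos[OF assms(1), of m]
    by (metis add.assoc add_pos_pos less_add_same_cancel1)
qed

lemma recurrent_shift: "recurrent w \<Longrightarrow> recurrent (\<lambda>n. w (n + k))"
  using recurrentD[of w "_ + k"] by (simp add: recurrent_def add_ac)

lemma recurrent_combination: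
  assumes "recurrent v" "recurrent w"
  shows "recurrent (\<lambda>n. b * v n - a * w n)"
  using assms unfolding recurrent_def by (simp add: algebra_simps)

text \<open>The constant coefficient of the recurrence is \<open>1\<close>, so each term is determined by the five that
  follow it; vanishing therefore spreads from the tail down to the start.\<close>

lemma recurrent_eventually_zero:
  assumes "recurrent z" "eventually (\<lambda>n. z n = 0) sequentially"
  shows "z n = 0"
proof -
  obtain N where N: "\<And>n. n \<ge> N \<Longrightarrow> z n = 0"
    using assms(2) by (auto simp: eventually_sequentially)
  have "\<forall>n\<ge>N - k. z n = 0" for k
  proof (induction k)
    case 0
    then show ?case using N by simp
  next
    case (Suc k)
    show ?case
    proof (intro allI impI)
      fix n assume "n \<ge> N - Suc k"
      with Suc have "z (n + 1) = 0" "z (n + 2) = 0" "z (n + 3) = 0" "z (n + 5) = 0"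
        by simp_all
      with recurrentD[OF assms(1), of n] show "z n = 0" by simp
    qed
  qed
  from this[of N] show ?thesis by simp
qed

text \<open>The proportionality transfers the equality of the terms \<open>2\<close> and \<open>4\<close> of the left sequence to
  the terms \<open>j + 2\<close> and \<open>j + 4\<close> of the right one, where \<open>wseq_step_two\<close> forbids it once \<open>j > 0\<close>.
  For \<open>j = 0\<close> the terms \<open>0\<close> and \<open>3\<close> force \<open>c = d\<close>.\<close>

lemma wseq_not_proportional_to_later:
  assumes "b \<noteq> 0" "c > 0" "c \<noteq> d" "\<And>n. b * wseq d n = a * wseq c (n + j)"
  shows False
proof (cases "j = 0")
  case True
  with assms(4)[of 0] assms(4)[of 3] assms(1,3) show False
    by (simp add: wseq_initial)
next
  case False
  have "a * wseq c (j + 2) = a * wseq c (j + 4)"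
    using assms(4)[of 2] assms(4)[of 4] by (simp add: wseq_initial add.commute)
  moreover have "a \<noteq> 0"
    using assms(1) assms(4)[of 0] by (auto simp: wseq_initial)
  moreover have "wseq c (j + 2) < wseq c (j + 4)"
    using wseq_step_two[of c "j + 2"] assms(2) False
    by (simp add: add.assoc del: add_2_eq_Suc' add_2_eq_Suc)
  ultimately show False by simp
qed

section \<open>The Pisot number\<close>

text \<open>The bounds have to be this narrow: the positivity of the quadratic form in
  \<open>cofactor_kernel_tendsto_0\<close> is checked with them, and it could not be checked
  with the bounds \<open>1.5\<close> and \<open>1.6\<close>.\<close>

locale pisot_root =
  fixes \<gamma> :: real
  assumes lower: "153/100 < \<gamma>" and upper: "\<gamma> < 154/100"
    and root: "\<gamma> ^ 5 = \<gamma> ^ 3 + \<gamma>\<^sup>2 + \<gamma> + 1"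

lemma pisot_root_exists: "\<exists>\<gamma>. pisot_root \<gamma>"
proof -
  let ?p = "\<lambda>x::real. x ^ 5 - x ^ 3 - x\<^sup>2 - x - 1"
  have "\<exists>x\<ge>153/100. x \<le> 154/100 \<and> ?p x = 0"
    by (rule IVT') (auto intro!: continuous_intros simp: power_numeral_reduce)
  then obtain x where x: "153/100 \<le> x" "x \<le> 154/100" "?p x = 0"
    by blast
  moreover have "?p (153/100) \<noteq> 0" "?p (154/100) \<noteq> 0"
    by (simp_all add: power_divide)
  with x(3) have "x \<noteq> 153/100" "x \<noteq> 154/100"
    by blast+
  ultimately show ?thesis
    by (intro exI[of _ x]) (simp add: pisot_root_def)
qed

context pisot_root
begin

text \<open>The polynomial \<open>Q(x) = P(x) / (x - \<gamma>)\<close>, with the index shift substituted for \<open>x\<close>, applied to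
  \<open>e\<close>. It annihilates the contributions of all roots of \<open>P\<close> but \<open>\<gamma>\<close>.\<close>

definition cofactor :: "(nat \<Rightarrow> real) \<Rightarrow> nat \<Rightarrow> real" where
  "cofactor e n = e (n + 4) + \<gamma> * e (n + 3) + (\<gamma>\<^sup>2 - 1) * e (n + 2)
     + (\<gamma> ^ 3 - \<gamma> - 1) * e (n + 1) + (\<gamma> ^ 4 - \<gamma>\<^sup>2 - \<gamma> - 1) * e n"

lemma gamma_gt_1: "\<gamma> > 1"
  using lower by simp

lemma power_bounds:
  "\<gamma>\<^sup>2 > 234/100" "\<gamma>\<^sup>2 < 238/100" "\<gamma> ^ 3 > 358/100" "\<gamma> ^ 3 < 366/100"
  using power_strict_mono[OF lower, of 2] power_strict_mono[OF lower, of 3]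
    power_strict_mono[OF upper, of 2] power_strict_mono[OF upper, of 3] lower
  by (simp_all add: power_numeral_reduce)

text \<open>The constant coefficient of \<open>Q\<close> is \<open>1/\<gamma>\<close>, because the roots of \<open>P\<close> have product \<open>1\<close>.\<close>

lemma constant_coeff: "\<gamma> * (\<gamma> ^ 4 - \<gamma>\<^sup>2 - \<gamma> - 1) = 1"
  using root by (simp add: algebra_simps power_numeral_reduce)

lemma constant_coeff_bounds:
  "64/100 < \<gamma> ^ 4 - \<gamma>\<^sup>2 - \<gamma> - 1" "\<gamma> ^ 4 - \<gamma>\<^sup>2 - \<gamma> - 1 < 66/100"
proof -
  have inv: "\<gamma> ^ 4 - \<gamma>\<^sup>2 - \<gamma> - 1 = 1 / \<gamma>"
    using constant_coeff lower by (simp add: field_simps)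
  have "64/100 < 1 / \<gamma>" "1 / \<gamma> < 66/100"
    using lower upper by (simp_all add: field_simps)
  then show "64/100 < \<gamma> ^ 4 - \<gamma>\<^sup>2 - \<gamma> - 1" "\<gamma> ^ 4 - \<gamma>\<^sup>2 - \<gamma> - 1 < 66/100"
    unfolding inv .
qed

text \<open>The factorisation \<open>P(x) = (x - \<gamma>) Q(x)\<close>, read as an identity of shift operators.\<close>

lemma cofactor_telescope:
  "cofactor w (Suc n) - \<gamma> * cofactor w n = w (n + 5) - w (n + 3) - w (n + 2) - w (n + 1) - w n"
proof -
  have "cofactor w (Suc n) - \<gamma> * cofactor w n = w (n + 5) - w (n + 3) - w (n + 2) - w (n + 1)
      - \<gamma> * (\<gamma> ^ 4 - \<gamma>\<^sup>2 - \<gamma> - 1) * w n"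
    by (simp add: cofactor_def algebra_simps eval_nat_numeral)
  then show ?thesis
    unfolding constant_coeff by simp
qed

lemma cofactor_Suc:
  assumes "recurrent w"
  shows "cofactor w (Suc n) = \<gamma> * cofactor w n"
  using cofactor_telescope[of w n] recurrentD[OF assms, of n] by simp

lemma cofactor_power:
  assumes "recurrent w"
  shows "cofactor w n = cofactor w 0 * \<gamma> ^ n"
  by (induction n) (simp_all add: cofactor_Suc[OF assms])

lemma cofactor_kernel_recurrent:
  assumes "\<And>n. cofactor e n = 0"
  shows "recurrent e"
  unfolding recurrent_def using cofactor_telescope[of e] assms by (simp add: algebra_simps)

text \<open>Multiplying \<open>P\<close> by \<open>x - 1\<close> gives \<open>x^4 (x^2 - x - 1) + 1\<close>, and on the unit circle
  \<open>|x^2 - x - 1|^2 = 1 + |x^2 - 1|^2\<close>. The usual argument would feed this inequality into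
  Rouche's theorem to locate the roots. Read as an identity for sequences, it says instead that the form
  \<open>V\<close> below drops by exactly \<open>(e (n + 6) - e (n + 4))^2\<close> at each step. On the kernel of \<open>Q\<close> the form
  is nonnegative, so these drops tend to \<open>0\<close>, and \<open>e\<close> is asymptotically of period two. Such
  behaviour is compatible with \<open>Q\<close> only in the limit \<open>0\<close>, since neither \<open>1\<close> nor \<open>-1\<close> is
  a root of \<open>Q\<close>.\<close>

lemma cofactor_kernel_tendsto_0:
  assumes "\<And>n. cofactor e n = 0"
  shows "e \<longlonglongrightarrow> 0"
proof -
  define q1 q0 where "q1 = \<gamma> ^ 3 - \<gamma> - 1" and "q0 = \<gamma> ^ 4 - \<gamma>\<^sup>2 - \<gamma> - 1"
  define V where "V n = (e n)\<^sup>2 + (e (n + 1))\<^sup>2 + (e (n + 2))\<^sup>2 + (e (n + 3))\<^sup>2 + (e (n + 4))\<^sup>2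
    - 2 * e (n + 4) * e (n + 5)" for n
  define f where "f n = e (n + 2) - e n" for n
  define g where "g n = f (n + 2) + \<gamma> * f (n + 1) + \<gamma>\<^sup>2 * f n" for n
  define X Y where "X = \<gamma>\<^sup>2 + q0" and "Y = \<gamma> ^ 3 - 1"
  have rec: "e (n + 4) = - \<gamma> * e (n + 3) - (\<gamma>\<^sup>2 - 1) * e (n + 2) - q1 * e (n + 1) - q0 * e n" for n
    using assms[of n] by (simp add: cofactor_def q1_def q0_def algebra_simps)
  have rec5: "e (n + 5) = e (n + 3) + e (n + 2) + e (n + 1) + e n" for n
    using cofactor_kernel_recurrent[OF assms] by (rule recurrentD)
  have V_step: "V n - V (Suc n) = (e (n + 6) - e (n + 4))\<^sup>2" for n
  proof -
    have e0: "e n = e (n + 5) + e (n + 4) - e (n + 6)"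
      using rec5[of n] rec5[of "Suc n"] by (simp add: eval_nat_numeral)
    have "V n - V (Suc n) = (e n)\<^sup>2 - (e (n + 5))\<^sup>2 - 2 * e (n + 4) * e (n + 5)
      + 2 * e (n + 5) * e (n + 6)"
      by (simp add: V_def eval_nat_numeral)
    then show ?thesis
      unfolding e0 by (simp add: power2_eq_square algebra_simps)
  qed
  have V_nonneg: "V n \<ge> 0" for n
  proof -
    have e5: "e (n + 5) = - \<gamma> * e (n + 4) - (\<gamma>\<^sup>2 - 1) * e (n + 3) - q1 * e (n + 2) - q0 * e (n + 1)"
      using rec[of "n + 1"] by (simp add: eval_nat_numeral)
    have "(\<gamma>\<^sup>2 - 1)\<^sup>2 \<le> (138/100)\<^sup>2" "q1\<^sup>2 \<le> (113/100)\<^sup>2" "q0\<^sup>2 \<le> (66/100)\<^sup>2"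
      using power_bounds constant_coeff_bounds lower upper unfolding q1_def q0_def
      by (intro power_mono; simp)+
    then have gap: "1 + 2 * \<gamma> - (\<gamma>\<^sup>2 - 1)\<^sup>2 - q1\<^sup>2 - q0\<^sup>2 \<ge> 0"
      using lower by (simp add: power_divide)
    \<comment> \<open>Substituting the recurrence for \<open>e (n + 5)\<close> leaves cross terms with \<open>e (n + 4)\<close> only,
      so that each of them can be absorbed by completing one square.\<close>
    have "V n = (e n)\<^sup>2 + (e (n + 1) + q0 * e (n + 4))\<^sup>2 + (e (n + 2) + q1 * e (n + 4))\<^sup>2
      + (e (n + 3) + (\<gamma>\<^sup>2 - 1) * e (n + 4))\<^sup>2
      + (1 + 2 * \<gamma> - (\<gamma>\<^sup>2 - 1)\<^sup>2 - q1\<^sup>2 - q0\<^sup>2) * (e (n + 4))\<^sup>2"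
      unfolding V_def e5 by (simp add: power2_eq_square algebra_simps)
    then show ?thesis using gap by simp
  qed
  have "decseq V"
    by (rule decseq_SucI) (use V_step in \<open>metis diff_ge_0_iff_ge zero_le_power2\<close>)
  then obtain L where L: "V \<longlonglongrightarrow> L"
    using decseq_convergent[of V 0] V_nonneg by blast
  have "(\<lambda>n. V n - V (Suc n)) \<longlonglongrightarrow> L - L"
    using L by (intro tendsto_diff LIMSEQ_Suc)
  then have "(\<lambda>n. sqrt ((f (n + 4))\<^sup>2)) \<longlonglongrightarrow> sqrt 0"
    by (intro tendsto_real_sqrt) (simp add: V_step f_def add.commute)
  then have "(\<lambda>n. f (n + 4)) \<longlonglongrightarrow> 0"
    by (simp add: tendsto_rabs_zero_iff)
  then have f: "f \<longlonglongrightarrow> 0"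
    by (rule LIMSEQ_offset)
  have f': "(\<lambda>n. f (n + k)) \<longlonglongrightarrow> 0" for k
    using f by (rule LIMSEQ_ignore_initial_segment)
  have "g \<longlonglongrightarrow> 0 + \<gamma> * 0 + \<gamma>\<^sup>2 * 0"
    unfolding g_def by (intro tendsto_intros f f')
  then have g: "g \<longlonglongrightarrow> 0" by simp
  \<comment> \<open>Replace \<open>e (n + 2)\<close> by \<open>e n\<close> etc. in the recurrence: \<open>X\<close> and \<open>Y\<close> are the sums of the coefficients
    of \<open>Q\<close> of even and odd degree, so that \<open>X + Y = Q(1)\<close> and \<open>X - Y = Q(-1)\<close>.\<close>
  have XY: "X * e n + Y * e (n + 1) = - g n" for n
    using rec[of n]
    by (simp add: X_def Y_def g_def f_def q1_def algebra_simps eval_nat_numeral)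
  \<comment> \<open>Eliminate \<open>e (n + 1)\<close> between the relations \<open>XY\<close> for \<open>n\<close> and \<open>n + 1\<close>.\<close>
  have "(X\<^sup>2 - Y\<^sup>2) * e n = - X * g n + Y * (g (Suc n) + Y * f n)" for n
  proof -
    have gn: "g n = - X * e n - Y * e (n + 1)" "g (Suc n) = - X * e (n + 1) - Y * e (n + 2)"
      using XY[of n] XY[of "Suc n"] by simp_all
    show ?thesis
      unfolding gn f_def by (simp add: power2_eq_square algebra_simps)
  qed
  moreover have "(\<lambda>n. - X * g n + Y * (g (Suc n) + Y * f n)) \<longlonglongrightarrow> - X * 0 + Y * (0 + Y * 0)"
    by (intro tendsto_intros f g LIMSEQ_Suc)
  ultimately have "(\<lambda>n. (X\<^sup>2 - Y\<^sup>2) * e n) \<longlonglongrightarrow> 0" by simp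
  moreover have "X\<^sup>2 - Y\<^sup>2 \<noteq> 0"
  proof -
    have "Y < X" "0 < Y"
      using power_bounds constant_coeff_bounds by (simp_all add: X_def Y_def q0_def)
    then have "Y\<^sup>2 < X\<^sup>2" by (intro power_strict_mono) simp_all
    then show ?thesis by simp
  qed
  ultimately show ?thesis
    using tendsto_mult_left_iff[of "X\<^sup>2 - Y\<^sup>2" e 0 sequentially] by simp
qed

text \<open>The coefficient \<open>A\<close> in \<open>w n = A \<gamma>^n + o(1)\<close>: applying \<open>Q\<close> to both sides kills the error term, so
  \<open>A\<close> is the quotient of the values of \<open>Q\<close> on \<open>w\<close> and on the powers of \<open>\<gamma>\<close>. The
  formula makes sense for any \<open>w\<close>, but has this meaning for recurrent ones.\<close>

definition dominant_coeff :: "(nat \<Rightarrow> int) \<Rightarrow> real" where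
  "dominant_coeff w = cofactor (\<lambda>n. real_of_int (w n)) 0 / cofactor (\<lambda>n. \<gamma> ^ n) 0"

text \<open>All coefficients of \<open>Q\<close> are positive.\<close>

lemma cofactor_pos:
  assumes "\<And>n. w n > 0"
  shows "cofactor w n > 0"
proof -
  have "0 < \<gamma>" "0 < \<gamma>\<^sup>2 - 1" "0 < \<gamma> ^ 3 - \<gamma> - 1" "0 < \<gamma> ^ 4 - \<gamma>\<^sup>2 - \<gamma> - 1"
    using lower upper power_bounds constant_coeff_bounds by simp_all
  then show ?thesis
    unfolding cofactor_def by (intro add_pos_pos mult_pos_pos assms)
qed

lemma dominant_coeff_pos:
  assumes "\<And>n. w n > 0"
  shows "dominant_coeff w > 0"
  unfolding dominant_coeff_def using assms gamma_gt_1
  by (intro divide_pos_pos cofactor_pos) simp_all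

text \<open>The leading coefficient is chosen such that the error lies in the kernel of \<open>Q\<close>.\<close>

lemma recurrent_asymptotics:
  assumes "recurrent w"
  shows "(\<lambda>n. real_of_int (w n) - dominant_coeff w * \<gamma> ^ n) \<longlonglongrightarrow> 0"
proof (rule cofactor_kernel_tendsto_0)
  fix n
  let ?w = "\<lambda>n. real_of_int (w n)" and ?p = "\<lambda>n. \<gamma> ^ n"
  have "recurrent ?w"
    using assms unfolding recurrent_def by (metis of_int_add)
  then have w: "cofactor ?w n = cofactor ?w 0 * \<gamma> ^ n"
    by (rule cofactor_power)
  have p: "cofactor ?p n = cofactor ?p 0 * \<gamma> ^ n"
    by (simp add: cofactor_def algebra_simps power_add)
  have "cofactor ?p 0 > 0"
    using gamma_gt_1 by (intro cofactor_pos) simp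
  moreover have "cofactor (\<lambda>n. ?w n - dominant_coeff w * \<gamma> ^ n) n
    = cofactor ?w n - dominant_coeff w * cofactor ?p n"
    by (simp add: cofactor_def algebra_simps)
  ultimately show "cofactor (\<lambda>n. ?w n - dominant_coeff w * \<gamma> ^ n) n = 0"
    by (simp add: w p dominant_coeff_def)
qed

text \<open>If \<open>w n = 3 u + 1\<close> and \<open>A \<gamma>^n\<close> is within \<open>1/2\<close> of \<open>w n\<close>, then \<open>(2/3) A \<gamma>^n\<close> is within \<open>1/3\<close> of
  \<open>2 u + 2/3\<close>, hence strictly between \<open>2 u\<close> and \<open>2 u + 1\<close>.\<close>

lemma eventually_even_floor:
  assumes "recurrent w" "\<And>n. w n mod 3 = 1"
  shows "eventually (\<lambda>n. even \<lfloor>2/3 * dominant_coeff w * \<gamma> ^ n\<rfloor>) sequentially"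
proof -
  have "eventually (\<lambda>n. dist (real_of_int (w n) - dominant_coeff w * \<gamma> ^ n) 0 < 1/2) sequentially"
    using recurrent_asymptotics[OF assms(1)] by (rule tendstoD) simp
  then show ?thesis
  proof eventually_elim
    case (elim n)
    have "w n = 3 * (w n div 3) + 1"
      using assms(2)[of n] by (metis mult_div_mod_eq)
    then have "real_of_int (w n) = 3 * real_of_int (w n div 3) + 1"
      by (metis of_int_1 of_int_add of_int_mult of_int_numeral)
    with elim have "\<bar>3 * real_of_int (w n div 3) + 1 - dominant_coeff w * \<gamma> ^ n\<bar> < 1/2"
      by (simp add: dist_real_def)
    then have "\<lfloor>2/3 * dominant_coeff w * \<gamma> ^ n\<rfloor> = 2 * (w n div 3)"
      unfolding abs_less_iff by (intro floor_unique) (simp_all add: field_simps)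
    then show ?case by simp
  qed
qed

text \<open>Under the hypothesis the exponential parts of both sides cancel, so their difference tends to \<open>0\<close>.
  As a sequence of integers it is eventually \<open>0\<close>, and as a solution of the recurrence it is
  then \<open>0\<close> throughout.\<close>

lemma proportional_of_dominant_coeff:
  assumes "recurrent v" "recurrent w"
    and "real_of_int b * dominant_coeff v * \<gamma> ^ i = real_of_int a * dominant_coeff w * \<gamma> ^ j"
  shows "b * v (n + i) = a * w (n + j)"
proof -
  let ?z = "\<lambda>n. b * v (n + i) - a * w (n + j)"
  let ?e = "\<lambda>v n. real_of_int (v n) - dominant_coeff v * \<gamma> ^ n"
  have "(\<lambda>n. real_of_int b * ?e v (n + i) - real_of_int a * ?e w (n + j))
    \<longlonglongrightarrow> real_of_int b * 0 - real_of_int a * 0"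
    by (intro tendsto_intros LIMSEQ_ignore_initial_segment recurrent_asymptotics assms)
  moreover have "b * ?e v (n + i) - a * ?e w (n + j) = real_of_int (?z n)" for n
  proof -
    have "b * (dominant_coeff v * \<gamma> ^ (n + i)) = a * (dominant_coeff w * \<gamma> ^ (n + j))"
      using arg_cong[OF assms(3), of "\<lambda>x. x * \<gamma> ^ n"] by (simp add: power_add mult_ac)
    then show ?thesis by (simp add: algebra_simps)
  qed
  ultimately have "(\<lambda>n. real_of_int (?z n)) \<longlonglongrightarrow> 0" by simp
  then have "eventually (\<lambda>n. dist (real_of_int (?z n)) 0 < 1) sequentially"
    by (rule tendstoD) simp
  then have "eventually (\<lambda>n. ?z n = 0) sequentially"
    by eventually_elim (simp add: dist_real_def flip: of_int_mult of_int_diff)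
  moreover have "recurrent ?z"
    using assms by (intro recurrent_combination recurrent_shift)
  ultimately have "?z n = 0" by (intro recurrent_eventually_zero)
  then show ?thesis by simp
qed

text \<open>Shifts are only available to the right, so the sign of \<open>k\<close> decides which of the two sequences
  is shifted.\<close>

lemma dominant_coeff_ratio:
  assumes "r \<in> \<rat>"
  shows "dominant_coeff (wseq 4) / dominant_coeff (wseq 1) \<noteq> r * \<gamma> powi k"
proof
  let ?A = "dominant_coeff (wseq 1)" and ?B = "dominant_coeff (wseq 4)"
  assume eq: "?B / ?A = r * \<gamma> powi k"
  have pos: "?A > 0" "?B > 0"
    by (simp_all add: dominant_coeff_pos wseq_pos)
  obtain a b :: int where b: "b > 0" and r: "r = a / b"
    using assms by (metis Rats_cases')
  have a: "a \<noteq> 0"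
    using eq pos by (auto simp: r)
  show False
  proof (cases "k \<ge> 0")
    case True
    then have "real_of_int b * ?B * \<gamma> ^ 0 = real_of_int a * ?A * \<gamma> ^ nat k"
      using eq pos b by (simp add: r power_int_def field_simps)
    from proportional_of_dominant_coeff[OF recurrent_wseq recurrent_wseq this]
    have "b * wseq 4 n = a * wseq 1 (n + nat k)" for n by simp
    with b show False
      by (intro wseq_not_proportional_to_later[of b 1 4 a "nat k"]) simp_all
  next
    case False
    then have "real_of_int a * ?A * \<gamma> ^ 0 = real_of_int b * ?B * \<gamma> ^ nat (- k)"
      using eq pos b gamma_gt_1 by (simp add: r power_int_def field_simps)
    from proportional_of_dominant_coeff[OF recurrent_wseq recurrent_wseq this]
    have "a * wseq 1 n = b * wseq 4 (n + nat (- k))" for n by simp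
    with a show False
      by (intro wseq_not_proportional_to_later[of a 4 1 b "nat (- k)"]) simp_all
  qed
qed

end

section \<open>Consequences of evenness and of the ratio condition\<close>

text \<open>If the floors agree, then \<open>\<beta> \<gamma>^n\<close> and \<open>\<alpha> \<gamma>^(n + k)\<close> differ by less than \<open>1\<close> for every \<open>n\<close>; as the
  difference is a multiple of \<open>\<gamma>^n\<close>, it has to vanish.\<close>

lemma floor_geom_tail_ratio:
  assumes "\<gamma> > 1" "is_tail_of (floor_geom \<beta> \<gamma>) (floor_geom \<alpha> \<gamma>)"
  shows "\<exists>k. \<beta> = \<alpha> * \<gamma> ^ k"
proof -
  obtain k where k: "\<And>n. floor_geom \<beta> \<gamma> n = floor_geom \<alpha> \<gamma> (n + k)"
    using assms(2) unfolding is_tail_of_def by metis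
  have bound: "\<bar>\<beta> - \<alpha> * \<gamma> ^ k\<bar> * \<gamma> ^ n < 1" for n
  proof -
    have "\<bar>\<beta> * \<gamma> ^ n - \<alpha> * \<gamma> ^ (n + k)\<bar> < 1"
      using k[of n] unfolding floor_geom_def by linarith
    moreover have "\<beta> * \<gamma> ^ n - \<alpha> * \<gamma> ^ (n + k) = (\<beta> - \<alpha> * \<gamma> ^ k) * \<gamma> ^ n"
      by (simp add: power_add algebra_simps)
    ultimately show ?thesis
      using assms(1) by (simp add: abs_mult)
  qed
  have "\<beta> = \<alpha> * \<gamma> ^ k"
  proof (rule ccontr)
    assume "\<beta> \<noteq> \<alpha> * \<gamma> ^ k"
    then have pos: "\<bar>\<beta> - \<alpha> * \<gamma> ^ k\<bar> > 0" by simp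
    obtain n where "1 / \<bar>\<beta> - \<alpha> * \<gamma> ^ k\<bar> < \<gamma> ^ n"
      using real_arch_pow[OF assms(1)] by blast
    with pos bound[of n] show False by (simp add: field_simps)
  qed
  then show ?thesis ..
qed

lemma even_not_complete:
  assumes "\<And>n. even (x n)"
  shows "\<not> complete_seq x"
proof
  assume "complete_seq x"
  then obtain N where N: "\<And>m. m \<ge> N \<Longrightarrow> \<exists>I. finite I \<and> m = (\<Sum>i\<in>I. x i)"
    unfolding complete_seq_def by blast
  obtain I where "2 * \<bar>N\<bar> + 1 = (\<Sum>i\<in>I. x i)"
    using N[of "2 * \<bar>N\<bar> + 1"] by fastforce
  moreover have "even (\<Sum>i\<in>I. x i)"
    using assms by (intro dvd_sum) simp
  ultimately have "even (2 * \<bar>N\<bar> + 1)" by metis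
  then show False by simp
qed

theorem corollary12:
  "\<exists>\<gamma> \<alpha> \<beta> :: real.
     1 < \<gamma> \<and> \<gamma> < golden_ratio \<and> 0 < \<alpha> \<and> 0 < \<beta> \<and>
     (\<forall>n. even (floor_geom \<alpha> \<gamma> n)) \<and> (\<forall>n. even (floor_geom \<beta> \<gamma> n)) \<and>
     (\<forall>r\<in>\<rat>. \<forall>k::int. \<beta> / \<alpha> \<noteq> r * \<gamma> powi k) \<and>
     \<alpha> / \<beta> \<notin> \<rat> \<and>
     \<not> is_tail_of (floor_geom \<alpha> \<gamma>) (floor_geom \<beta> \<gamma>) \<and>
     \<not> is_tail_of (floor_geom \<beta> \<gamma>) (floor_geom \<alpha> \<gamma>) \<and>
     \<not> complete_seq (interleaving (floor_geom \<alpha> \<gamma>) (floor_geom \<beta> \<gamma>))"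
proof -
  obtain \<gamma> where "pisot_root \<gamma>"
    using pisot_root_exists by blast
  then interpret pisot_root \<gamma> .
  let ?A = "dominant_coeff (wseq 1)" and ?B = "dominant_coeff (wseq 4)"
  have "eventually (\<lambda>n. even \<lfloor>2/3 * ?A * \<gamma> ^ n\<rfloor>) sequentially"
    "eventually (\<lambda>n. even \<lfloor>2/3 * ?B * \<gamma> ^ n\<rfloor>) sequentially"
    by (intro eventually_even_floor recurrent_wseq wseq_mod_3; simp)+
  then have "eventually (\<lambda>n. even \<lfloor>2/3 * ?A * \<gamma> ^ n\<rfloor> \<and> even \<lfloor>2/3 * ?B * \<gamma> ^ n\<rfloor>) sequentially"
    by (rule eventually_conj)
  then obtain N where N:
    "\<And>n. n \<ge> N \<Longrightarrow> even \<lfloor>2/3 * ?A * \<gamma> ^ n\<rfloor>" "\<And>n. n \<ge> N \<Longrightarrow> even \<lfloor>2/3 * ?B * \<gamma> ^ n\<rfloor>"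
    by (auto simp: eventually_sequentially)
  \<comment> \<open>The same \<open>N\<close> serves both sequences, so the ratio of the coefficients is unchanged.\<close>
  define \<alpha> \<beta> where "\<alpha> = 2/3 * ?A * \<gamma> ^ N" and "\<beta> = 2/3 * ?B * \<gamma> ^ N"
  have "sqrt 5 > 22/10"
    by (rule real_less_rsqrt) (simp add: power2_eq_square)
  then have golden: "\<gamma> < golden_ratio"
    using upper by (simp add: golden_ratio_def)
  have pos: "0 < \<alpha>" "0 < \<beta>"
    using gamma_gt_1 by (simp_all add: \<alpha>_def \<beta>_def dominant_coeff_pos wseq_pos)
  have even: "even (floor_geom \<alpha> \<gamma> n)" "even (floor_geom \<beta> \<gamma> n)" for n
    using N[of "N + n"] by (simp_all add: floor_geom_def \<alpha>_def \<beta>_def power_add mult.assoc)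
  have "\<beta> / \<alpha> = ?B / ?A"
    using gamma_gt_1 by (simp add: \<alpha>_def \<beta>_def)
  then have ratio: "\<beta> / \<alpha> \<noteq> r * \<gamma> powi k" if "r \<in> \<rat>" for r k
    using dominant_coeff_ratio[OF that] by simp
  have irrational: "\<alpha> / \<beta> \<notin> \<rat>"
  proof
    assume "\<alpha> / \<beta> \<in> \<rat>"
    then have "inverse (\<alpha> / \<beta>) \<in> \<rat>" by (rule Rats_inverse)
    with ratio[of "\<beta> / \<alpha>" 0] show False by simp
  qed
  have tail1: "\<not> is_tail_of (floor_geom \<alpha> \<gamma>) (floor_geom \<beta> \<gamma>)"
  proof
    assume "is_tail_of (floor_geom \<alpha> \<gamma>) (floor_geom \<beta> \<gamma>)"
    then obtain k where "\<alpha> = \<beta> * \<gamma> ^ k"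
      using floor_geom_tail_ratio[OF gamma_gt_1] by blast
    then have "\<beta> / \<alpha> = 1 * \<gamma> powi (- int k)"
      using pos gamma_gt_1 by (simp add: power_int_minus field_simps)
    with ratio[of 1 "- int k"] show False by simp
  qed
  have tail2: "\<not> is_tail_of (floor_geom \<beta> \<gamma>) (floor_geom \<alpha> \<gamma>)"
  proof
    assume "is_tail_of (floor_geom \<beta> \<gamma>) (floor_geom \<alpha> \<gamma>)"
    then obtain k where "\<beta> = \<alpha> * \<gamma> ^ k"
      using floor_geom_tail_ratio[OF gamma_gt_1] by blast
    then have "\<beta> / \<alpha> = 1 * \<gamma> powi (int k)"
      using pos by simp
    with ratio[of 1 "int k"] show False by simp
  qed
  have "\<not> complete_seq (interleaving (floor_geom \<alpha> \<gamma>) (floor_geom \<beta> \<gamma>))"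
    by (rule even_not_complete) (simp add: interleaving_def even)
  with gamma_gt_1 golden pos even ratio irrational tail1 tail2 show ?thesis
    by blast
qed

end
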